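(* For each $j\in[m]$, let $\Lambda_j=\{\Lambda_{ij}\}_{i\in I}$ be a g-frame for $\mathcal H$ with frame bounds $A_j$ and $B_j$. Assume that there exist non-negative scalars $\lambda_j,\eta_j,\mu_j$ $(j\in[m])$ such that for some fixed $n\in[m]$, $$A=A_n-\sum_{j\in[m]\setminus\{n\}}(\lambda_j+\eta_j\sqrt{B_n}+\mu_j\sqrt{B_j})(\sqrt{B_n}+\sqrt{B_j})>0$$ and $$\Big\|\sum_{i\in J}(\Lambda_{in}^*-\Lambda_{ij}^* )g_i\Big\|\le\eta_j\Big\|\sum_{i\in J}\Lambda_{in}^*g_i\Big\|+\mu_j\Big\|\sum_{i\in J}\Lambda_{ij}^*g_i\Big\|+\lambda_j\Big(\sum_{i\in J}\|g_i\|^2\Big)^{1/2}$$ for any finite subset $J\subset I$, any $g_i\in\mathcal H_i$ $(i\in J)$ and any $j\in[m]\setminus\{n\}$. Then for any partition $\{\sigma_j\}_{j\in[m]}$ of $I$, the family $\{\Lambda_{ij}\}_{i\in\sigma_j,\,j\in[m]}$ is a g-frame for $\mathcal H$ with universal lower and upper frame bounds $A$ and $\sum_{j\in[m]}B_j$. Hence the family of g-frames $\{\Lambda_j\}_{j\in[m]}$ for $\mathcal H$ is woven.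
   Context: $\mathcal H$ and $\mathcal K$ are Hilbert spaces, $I\subset\mathbb N$, $\{\mathcal H_i\}_{i\in I}$ is a sequence of closed subspaces of $\mathcal K$, $\Lambda_{ij}\in L(\mathcal H,\mathcal H_i)$ are bounded linear operators, and $[m]=\{1,\dots,m\}$. A family of operators is a g-frame for $\mathcal H$ with bounds $A,B$ if $A,B>0$ are constants such that, for all $f\in\mathcal H$, the sum of $\|\Lambda f\|^2$ over the members $\Lambda$ of the family lies between $A\|f\|^2$ and $B\|f\|^2$. A partition $\{\sigma_j\}_{j\in[m]}$ of $I$ is a family of pairwise disjoint (possibly empty) subsets whose union is $I$. A family of g-frames $\{\Lambda_{ij}\}_{i\in I,j\in[m]}$ is woven if there are universal constants $A,B>0$ such that for every partition $\{\sigma_j\}_{j\in[m]}$ of $I$ the family $\{\Lambda_{ij}\}_{i\in\sigma_j,j\in[m]}$ is a g-frame for $\mathcal H$ with lower and upper bounds $A$ and $B$. *)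

theory Defs
  imports "HOL-Analysis.Analysis"
begin

(* The scalar field of a Hilbert space, i.e. the reals or the complex numbers.  HOL-Analysis only
   has real inner product spaces; this class lets both cases be treated at once. *)
class rc_field = real_normed_field +
  fixes scnj :: "'a \<Rightarrow> 'a"
  assumes scnj_add: "scnj (a + b) = scnj a + scnj b"
    and scnj_mult: "scnj (a * b) = scnj a * scnj b"
    and mult_scnj: "a * scnj a = (norm a)\<^sup>2 *\<^sub>R 1"

instantiation real :: rc_field
begin
definition scnj_real :: "real \<Rightarrow> real" where "scnj_real a = a"
instance by standard (simp_all add: scnj_real_def power2_eq_square)
end

instantiation complex :: rc_field
begin
definition scnj_complex :: "complex \<Rightarrow> complex" where "scnj_complex a = cnj a"
instance
proof
  fix a b :: complex
  show "scnj (a + b) = scnj a + scnj b" "scnj (a * b) = scnj a * scnj b"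
    by (simp_all add: scnj_complex_def)
  show "a * scnj a = (norm a)\<^sup>2 *\<^sub>R 1"
    unfolding scnj_complex_def complex_norm_square[symmetric] by (simp only: of_real_def)
qed
end

(* Completeness comes from the sort banach.  The norm and the real scalar multiplication of the
   type are those induced by ip and smul; ip is linear in its first argument. *)
locale hilbert_space = vector_space smul
  for smul :: "'k::rc_field \<Rightarrow> 'a::banach \<Rightarrow> 'a" +
  fixes ip :: "'a \<Rightarrow> 'a \<Rightarrow> 'k"
  assumes smul_of_real: "smul (of_real r) x = r *\<^sub>R x"
    and ip_add_left: "ip (x + y) z = ip x z + ip y z"
    and ip_smul_left: "ip (smul a x) y = a * ip x y"
    and ip_commute: "ip y x = scnj (ip x y)"
    and ip_self: "ip x x = of_real ((norm x)\<^sup>2)"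

lemma hilbert_space_real:
  "hilbert_space (scaleR :: real \<Rightarrow> 'a::{real_inner,banach} \<Rightarrow> 'a) inner"
proof unfold_locales
  fix x y :: 'a
  show "inner y x = scnj (inner x y)"
    by (simp add: scnj_real_def inner_commute)
  show "inner x x = of_real ((norm x)\<^sup>2)"
    unfolding power2_norm_eq_inner by simp
qed (simp_all add: scaleR_add_right scaleR_add_left inner_add_left)

lemma hilbert_space_complex: "hilbert_space ((*) :: complex \<Rightarrow> complex \<Rightarrow> complex) (\<lambda>x y. x * cnj y)"
proof unfold_locales
  fix x y :: complex
  show "y * cnj x = scnj (x * cnj y)"
    by (simp add: scnj_complex_def)
  show "x * cnj x = of_real ((norm x)\<^sup>2)"
    by (rule complex_norm_square[symmetric])
qed (simp_all add: distrib_left distrib_right scaleR_conv_of_real)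

definition closed_subspace :: "('k::rc_field \<Rightarrow> 'a::banach \<Rightarrow> 'a) \<Rightarrow> 'a set \<Rightarrow> bool" where
  "closed_subspace smul W \<longleftrightarrow> module.subspace smul W \<and> closed W"

(* T \<in> L(H, W), where W is a subspace of the codomain *)
definition bounded_operator_into ::
  "('k::rc_field \<Rightarrow> 'a::banach \<Rightarrow> 'a) \<Rightarrow> ('k \<Rightarrow> 'b::banach \<Rightarrow> 'b) \<Rightarrow> 'b set \<Rightarrow> ('a \<Rightarrow> 'b) \<Rightarrow> bool" where
  "bounded_operator_into smulH smulK W T \<longleftrightarrow>
     Vector_Spaces.linear smulH smulK T \<and> (\<exists>C. \<forall>f. norm (T f) \<le> C * norm f) \<and> range T \<subseteq> W"

(* For T in L(H, W), the adjoint W \<rightarrow> H is the restriction of this function to W, since W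
   carries the inner product of the ambient space. *)
definition hilbert_adjoint ::
  "('a \<Rightarrow> 'a \<Rightarrow> 'k) \<Rightarrow> ('b \<Rightarrow> 'b \<Rightarrow> 'k) \<Rightarrow> ('a \<Rightarrow> 'b) \<Rightarrow> 'b \<Rightarrow> 'a" where
  "hilbert_adjoint ipH ipK T g = (THE h. \<forall>f. ipK (T f) g = ipH f h)"

definition g_frame_bounds ::
  "'i set \<Rightarrow> ('i \<Rightarrow> 'a::real_normed_vector \<Rightarrow> 'b::real_normed_vector) \<Rightarrow> real \<Rightarrow> real \<Rightarrow> bool" where
  "g_frame_bounds S \<Lambda> A B \<longleftrightarrow> A > 0 \<and> B > 0 \<and>
     (\<forall>f. (\<lambda>i. (norm (\<Lambda> i f))\<^sup>2) summable_on S \<and>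
          A * (norm f)\<^sup>2 \<le> (\<Sum>\<^sub>\<infinity>i\<in>S. (norm (\<Lambda> i f))\<^sup>2) \<and>
          (\<Sum>\<^sub>\<infinity>i\<in>S. (norm (\<Lambda> i f))\<^sup>2) \<le> B * (norm f)\<^sup>2)"

(* Empty parts are allowed, so this is not HOL-Library's partition_on. *)
definition is_partition :: "nat set \<Rightarrow> nat \<Rightarrow> (nat \<Rightarrow> nat set) \<Rightarrow> bool" where
  "is_partition I m \<sigma> \<longleftrightarrow> disjoint_family_on \<sigma> {1..m} \<and> (\<Union>j\<in>{1..m}. \<sigma> j) = I"

definition weaving_g_frame_bounds ::
  "nat \<Rightarrow> (nat \<Rightarrow> nat set) \<Rightarrow> (nat \<Rightarrow> nat \<Rightarrow> 'a::real_normed_vector \<Rightarrow> 'b::real_normed_vector)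
     \<Rightarrow> real \<Rightarrow> real \<Rightarrow> bool" where
  "weaving_g_frame_bounds m \<sigma> \<Lambda> A B \<longleftrightarrow>
     g_frame_bounds {(i, j). j \<in> {1..m} \<and> i \<in> \<sigma> j} (\<lambda>(i, j). \<Lambda> i j) A B"

definition woven ::
  "nat set \<Rightarrow> nat \<Rightarrow> (nat \<Rightarrow> nat \<Rightarrow> 'a::real_normed_vector \<Rightarrow> 'b::real_normed_vector) \<Rightarrow> bool" where
  "woven I m \<Lambda> \<longleftrightarrow>
     (\<forall>j\<in>{1..m}. \<exists>A B. g_frame_bounds I (\<lambda>i. \<Lambda> i j) A B) \<and>
     (\<exists>A>0. \<exists>B>0. \<forall>\<sigma>. is_partition I m \<sigma> \<longrightarrow> weaving_g_frame_bounds m \<sigma> \<Lambda> A B)"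

end

(* Testing the hypothesis at g_i = (Lambda_in - Lambda_ij) f and passing to adjoints gives
   ||((Lambda_in - Lambda_ij) f)_i|| <= c_j ||f|| in l2, where
   c_j = lambda_j + eta_j sqrt B_n + mu_j sqrt B_j. Hence on each part sigma_j, replacing Lambda_in by
   Lambda_ij lowers the sum of squares by at most c_j (sqrt B_n + sqrt B_j) ||f||^2, and summing
   over j turns the lower bound A_n into A. The adjoints are defined by a definite description, so their
   existence is first obtained from the Riesz representation theorem. *)
theory Submission
  imports Defs
begin

section \<open>Scalar conjugation and elementary inner product geometry\<close>

lemma scnj_of_real: "scnj (of_real r :: 'k::rc_field) = of_real r"
proof (cases "r = 0")
  case True
  have "scnj (0::'k) = 0"
    using scnj_add[of "0::'k" 0] by simp
  then show ?thesis using True by simp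
next
  case False
  have "(of_real r :: 'k) * scnj (of_real r) = of_real r * of_real r"
    by (simp add: mult_scnj scaleR_conv_of_real power2_eq_square)
  then show ?thesis using False by simp
qed

lemma mult_scnj_of_real: "(a :: 'k::rc_field) * scnj a = of_real ((norm a)\<^sup>2)"
  by (simp add: mult_scnj scaleR_conv_of_real)

context hilbert_space
begin

lemma ip_add_right: "ip x (y + z) = ip x y + ip x z"
  by (metis ip_add_left ip_commute scnj_add)

lemma ip_smul_right: "ip x (smul a y) = scnj a * ip x y"
  by (metis ip_smul_left ip_commute scnj_mult)

lemma ip_zero_left [simp]: "ip 0 y = 0"
  using ip_add_left[of 0 0 y] by simp

lemma ip_zero_right [simp]: "ip x 0 = 0"
  using ip_add_right[of x 0 0] by simp

lemma ip_diff_left: "ip (x - y) z = ip x z - ip y z"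
  by (metis ip_add_left add_diff_cancel_right' diff_add_cancel)

lemma ip_diff_right: "ip x (y - z) = ip x y - ip x z"
  by (metis ip_add_right add_diff_cancel_right' diff_add_cancel)

lemma ip_sum_right: "ip x (\<Sum>i\<in>A. y i) = (\<Sum>i\<in>A. ip x (y i))"
  by (induction A rule: infinite_finite_induct) (simp_all add: ip_add_right)

lemma norm_ip_self: "norm (ip x x) = (norm x)\<^sup>2"
  by (simp add: ip_self del: of_real_power)

lemma ip_eq_right_imp_eq:
  assumes "\<And>x. ip x y = ip x z"
  shows "y = z"
  using assms[of "y - z"] norm_ip_self[of "y - z"] by (simp add: ip_diff_right)

lemma parallelogram_law:
  fixes x y :: 'a
  shows "(norm (x + y))\<^sup>2 + (norm (x - y))\<^sup>2 = 2 * (norm x)\<^sup>2 + 2 * (norm y)\<^sup>2"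
proof -
  have "ip (x + y) (x + y) + ip (x - y) (x - y) = 2 * ip x x + 2 * ip y y"
    by (simp add: ip_add_left ip_add_right ip_diff_left ip_diff_right)
  then have "(of_real ((norm (x + y))\<^sup>2 + (norm (x - y))\<^sup>2) :: 'k)
      = of_real (2 * (norm x)\<^sup>2 + 2 * (norm y)\<^sup>2)"
    by (simp add: ip_self)
  then show ?thesis by (simp only: of_real_eq_iff)
qed

text \<open>Pythagoras for the orthogonal projection of \<open>x\<close> onto the line spanned by
  \<open>y\<close>. It serves both for Cauchy-Schwarz and for the orthogonality argument behind the
  Riesz theorem.\<close>

lemma norm_diff_projection:
  assumes "y \<noteq> 0"
  shows "(norm (x - smul (ip x y / of_real ((norm y)\<^sup>2)) y))\<^sup>2
    = (norm x)\<^sup>2 - (norm (ip x y))\<^sup>2 / (norm y)\<^sup>2"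
proof -
  define r where "r = (norm y)\<^sup>2"
  define t where "t = ip x y / of_real r"
  have r: "r \<noteq> 0" using assms by (simp add: r_def)
  have tr: "t * of_real r = ip x y" using r by (simp add: t_def)
  have st: "scnj t * of_real r = scnj (ip x y)"
    using arg_cong[OF tr, of scnj] by (simp add: scnj_mult scnj_of_real)
  have "ip (x - smul t y) (x - smul t y)
      = ip x x - t * scnj (ip x y) - scnj t * ip x y + t * scnj t * of_real r"
    by (simp add: ip_diff_left ip_diff_right ip_smul_left ip_smul_right ip_self[of y]
        ip_commute[where y = y and x = x] r_def algebra_simps del: of_real_power)
  \<comment> \<open>By \<open>st\<close>, the last term equals \<open>t * scnj (ip x y)\<close> and
    cancels the second one.\<close>
  also have "\<dots> = ip x x - scnj t * ip x y"
    using st by (simp add: mult.assoc)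
  also have "scnj t = scnj (ip x y) / of_real r"
    using st r by (simp add: field_simps)
  also have "scnj (ip x y) / of_real r * ip x y = of_real ((norm (ip x y))\<^sup>2 / r)"
    by (simp add: mult_scnj_of_real[symmetric] mult.commute flip: of_real_power)
  finally have "(of_real ((norm (x - smul t y))\<^sup>2) :: 'k)
      = of_real ((norm x)\<^sup>2 - (norm (ip x y))\<^sup>2 / r)"
    by (simp add: ip_self)
  then show ?thesis by (simp only: of_real_eq_iff r_def t_def)
qed

lemma Cauchy_Schwarz: "norm (ip x y) \<le> norm x * norm y"
proof (cases "y = 0")
  case False
  have "(norm (ip x y))\<^sup>2 / (norm y)\<^sup>2 \<le> (norm x)\<^sup>2"
    using norm_diff_projection[OF False, of x]
    by (metis diff_ge_0_iff_ge zero_le_power2)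
  then have "(norm (ip x y))\<^sup>2 \<le> (norm x * norm y)\<^sup>2"
    using False by (simp add: divide_le_eq power_mult_distrib)
  then show ?thesis by (rule power2_le_imp_le) simp
qed simp

section \<open>The Riesz representation theorem\<close>

text \<open>The level set is a closed affine hyperplane, so midpoints stay in it. The parallelogram
  law then makes every minimising sequence Cauchy, and completeness and continuity supply the
  minimiser as its limit.\<close>

lemma ex_min_norm_level_set:
  fixes \<phi> :: "'a \<Rightarrow> 'k"
  assumes "bounded_linear \<phi>" and "\<phi> x0 = 1"
  obtains h where "\<phi> h = 1" and "\<And>x. \<phi> x = 1 \<Longrightarrow> norm h \<le> norm x"
proof -
  interpret bounded_linear \<phi> by fact
  define d where "d = (INF x\<in>{x. \<phi> x = 1}. norm x)"
  have bdd: "bdd_below (norm ` {x. \<phi> x = 1})"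
    by (rule bdd_belowI[of _ 0]) auto
  have d_le: "d \<le> norm x" if "\<phi> x = 1" for x
    unfolding d_def using bdd that by (intro cINF_lower) auto
  have d0: "0 \<le> d"
    unfolding d_def using assms(2) by (intro cINF_greatest) auto
  have "\<exists>x. \<phi> x = 1 \<and> norm x < d + 1 / Suc k" for k
  proof -
    have "{x. \<phi> x = 1} \<noteq> {}" using assms(2) by blast
    moreover have "(INF x\<in>{x. \<phi> x = 1}. norm x) < d + 1 / Suc k"
      unfolding d_def[symmetric] by simp
    ultimately show ?thesis
      using cINF_less_iff[OF _ bdd] by blast
  qed
  then obtain X where X: "\<And>k. \<phi> (X k) = 1" "\<And>k. norm (X k) < d + 1 / Suc k"
    by metis
  \<comment> \<open>The squared norms exceed \<open>d\<^sup>2\<close> by at most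
    \<open>(2 * d + 1) / Suc N\<close>, the quadratic error being absorbed since
    \<open>1 / Suc N\<close> is at most 1. The parallelogram law doubles both excesses, whence
    \<open>8 * d + 4\<close>.\<close>
  have gap: "(norm (X k - X l))\<^sup>2 \<le> (8 * d + 4) / Suc N" if "k \<ge> N" "l \<ge> N" for k l N
  proof -
    define e where "e = 1 / real (Suc N)"
    have e: "0 \<le> e" "e \<le> 1" by (simp_all add: e_def)
    have le: "(norm (X p))\<^sup>2 \<le> d\<^sup>2 + (2 * d + 1) * e" if "p \<ge> N" for p
    proof -
      have "1 / real (Suc p) \<le> e"
        unfolding e_def using that by (intro divide_left_mono) auto
      then have "norm (X p) \<le> d + e" using X(2)[of p] by linarith
      then have "(norm (X p))\<^sup>2 \<le> (d + e)\<^sup>2" by (intro power_mono) auto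
      also have "\<dots> = d\<^sup>2 + 2 * d * e + e * e" by (simp add: power2_eq_square algebra_simps)
      also have "e * e \<le> e" using e by (simp add: mult_left_le)
      finally show ?thesis by (simp add: algebra_simps)
    qed
    \<comment> \<open>The midpoint lies in the level set, so its norm is at least \<open>d\<close>;
      this cancels the terms \<open>d\<^sup>2\<close> in the parallelogram law.\<close>
    have "\<phi> ((1/2) *\<^sub>R (X k + X l)) = (1/2) *\<^sub>R (1 + 1)"
      by (simp only: scaleR add X(1))
    also have "\<dots> = (1::'k)" by (simp add: scaleR_conv_of_real)
    finally have "d \<le> norm ((1/2) *\<^sub>R (X k + X l))" by (rule d_le)
    then have "(2 * d)\<^sup>2 \<le> (norm (X k + X l))\<^sup>2"
      using d0 by (intro power_mono) auto
    then have "(norm (X k - X l))\<^sup>2 \<le> (8 * d + 4) * e"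
      using parallelogram_law[of "X k" "X l"] le[OF that(1)] le[OF that(2)]
      by (simp add: power_mult_distrib algebra_simps)
    then show ?thesis by (simp add: e_def)
  qed
  have "Cauchy X"
  proof (rule metric_CauchyI)
    fix e :: real assume e: "0 < e"
    have "(\<lambda>N. (8 * d + 4) / real (Suc N)) \<longlonglongrightarrow> 0"
      using LIMSEQ_Suc[OF lim_const_over_n[of "8 * d + 4"]] by simp
    then have "eventually (\<lambda>N. (8 * d + 4) / real (Suc N) < e\<^sup>2) sequentially"
      using e by (intro order_tendstoD(2)[where y = 0]) auto
    then obtain N where N: "(8 * d + 4) / real (Suc N) < e\<^sup>2"
      by (auto simp: eventually_sequentially)
    have "dist (X k) (X l) < e" if "k \<ge> N" "l \<ge> N" for k l
      unfolding dist_norm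
      using gap[OF that] N e by (intro power2_less_imp_less[of _ e]) linarith+
    then show "\<exists>M. \<forall>k\<ge>M. \<forall>l\<ge>M. dist (X k) (X l) < e" by blast
  qed
  then obtain h where h: "X \<longlonglongrightarrow> h"
    using Cauchy_convergent convergent_def by blast
  have "(\<lambda>k. \<phi> (X k)) \<longlonglongrightarrow> \<phi> h" by (rule tendsto[OF h])
  then have "\<phi> h = 1" using X(1) by (simp add: LIMSEQ_const_iff)
  moreover have "norm h \<le> d"
  proof (rule LIMSEQ_le)
    show "(\<lambda>k. norm (X k)) \<longlonglongrightarrow> norm h" by (rule tendsto_norm[OF h])
    show "(\<lambda>k. d + 1 / real (Suc k)) \<longlonglongrightarrow> d"
      using tendsto_add[OF tendsto_const[of d] LIMSEQ_Suc[OF lim_const_over_n[of 1]]] by simp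
  qed (use X(2) in \<open>auto intro: less_imp_le\<close>)
  ultimately show ?thesis using that d_le by (meson order_trans)
qed

text \<open>The vector \<open>h\<close> of least norm with \<open>\<phi> h = 1\<close> is orthogonal
  to the kernel of \<open>\<phi>\<close>. Since \<open>x - smul (\<phi> x) h\<close> lies in that
  kernel, pairing it with \<open>h\<close> recovers \<open>\<phi> x\<close> up to the factor
  \<open>(norm h)\<^sup>2\<close>.\<close>

theorem Riesz_representation:
  fixes \<phi> :: "'a \<Rightarrow> 'k"
  assumes add: "\<And>x y. \<phi> (x + y) = \<phi> x + \<phi> y"
    and scale: "\<And>a x. \<phi> (smul a x) = a * \<phi> x"
    and bound: "\<And>x. norm (\<phi> x) \<le> C * norm x"
  obtains h where "\<And>x. \<phi> x = ip x h"
proof (cases "\<forall>x. \<phi> x = 0")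
  case True
  then show ?thesis using that[of 0] by simp
next
  case False
  then obtain x1 where x1: "\<phi> x1 \<noteq> 0" by blast
  have bl: "bounded_linear \<phi>"
  proof (rule bounded_linear_intro[where K = C])
    show "\<phi> (r *\<^sub>R x) = r *\<^sub>R \<phi> x" for r x
      by (metis scale smul_of_real scaleR_conv_of_real)
  qed (auto simp: add bound mult.commute)
  \<comment> \<open>Normalising \<open>x1\<close> shows that the level set is nonempty.\<close>
  have "\<phi> (smul (inverse (\<phi> x1)) x1) = 1" using x1 by (simp add: scale)
  from ex_min_norm_level_set[OF bl this] obtain h
    where h: "\<phi> h = 1" and min: "\<And>x. \<phi> x = 1 \<Longrightarrow> norm h \<le> norm x" by metis
  have diff: "\<phi> (x - y) = \<phi> x - \<phi> y" for x y
    by (rule bounded_linear.axioms(1)[OF bl, THEN linear_diff])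
  have "h \<noteq> 0" using h add[of 0 0] by auto
  have orth: "ip z h = 0" if "\<phi> z = 0" for z
  proof (cases "z = 0")
    case False
    \<comment> \<open>Subtracting a multiple of the kernel vector \<open>z\<close> stays in the
      level set. Removing the projection onto \<open>z\<close> therefore cannot shorten
      \<open>h\<close>, which forces that projection to vanish.\<close>
    have "(norm h)\<^sup>2 \<le> (norm (h - smul (ip h z / of_real ((norm z)\<^sup>2)) z))\<^sup>2"
      by (intro power_mono min) (simp_all add: diff scale h that)
    then have "(norm (ip h z))\<^sup>2 / (norm z)\<^sup>2 \<le> 0"
      unfolding norm_diff_projection[OF False] by simp
    then have "ip h z = 0"
      using False by (simp add: divide_le_0_iff)
    then show ?thesis
      using ip_commute[where y = z and x = h] scnj_of_real[of 0, where 'k = 'k] by simp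
  qed simp
  have "\<phi> x = ip x ((1 / (norm h)\<^sup>2) *\<^sub>R h)" for x
  proof -
    have "ip (x - smul (\<phi> x) h) h = 0" by (rule orth) (simp add: diff scale h)
    then have "ip x h = \<phi> x * of_real ((norm h)\<^sup>2)"
      by (simp add: ip_diff_left ip_smul_left ip_self)
    moreover have "ip x ((1 / (norm h)\<^sup>2) *\<^sub>R h) = of_real (1 / (norm h)\<^sup>2) * ip x h"
      by (metis ip_smul_right smul_of_real scnj_of_real)
    ultimately show ?thesis using \<open>h \<noteq> 0\<close> by simp
  qed
  then show ?thesis by (rule that)
qed

end

section \<open>Adjoints, and analysis and synthesis bounds over finite sets\<close>

text \<open>Riesz, applied to the functional that sends \<open>f\<close> to
  \<open>ipK (T f) g\<close>, gives existence; uniqueness holds because inner products determine a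
  vector. Hence the definite description denotes the adjoint.\<close>

lemma hilbert_adjoint:
  assumes "hilbert_space smulH ipH" and "hilbert_space smulK ipK"
    and T: "bounded_operator_into smulH smulK W T"
  shows "ipK (T f) g = ipH f (hilbert_adjoint ipH ipK T g)"
proof -
  interpret H: hilbert_space smulH ipH by fact
  interpret K: hilbert_space smulK ipK by fact
  from T obtain C where "Vector_Spaces.linear smulH smulK T" and C: "\<And>f. norm (T f) \<le> C * norm f"
    by (auto simp: bounded_operator_into_def)
  then interpret T: Vector_Spaces.linear smulH smulK T by simp
  have "norm (ipK (T f) g) \<le> (C * norm g) * norm f" for f
  proof -
    have "norm (ipK (T f) g) \<le> norm (T f) * norm g" by (rule K.Cauchy_Schwarz)
    also have "\<dots> \<le> C * norm f * norm g" by (intro mult_right_mono C) simp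
    finally show ?thesis by (simp add: ac_simps)
  qed
  then obtain h where h: "\<And>f. ipK (T f) g = ipH f h"
    using H.Riesz_representation[of "\<lambda>f. ipK (T f) g" "C * norm g"]
    by (metis (no_types, lifting) K.ip_add_left K.ip_smul_left T.add T.scale)
  have "\<forall>f. ipK (T f) g = ipH f (hilbert_adjoint ipH ipK T g)"
    unfolding hilbert_adjoint_def
    by (rule theI[of _ h]) (use h H.ip_eq_right_imp_eq in \<open>metis+\<close>)
  then show ?thesis by blast
qed

lemma norm_sum_ip_le:
  assumes "hilbert_space smul ip"
  shows "norm (\<Sum>i\<in>J. ip (x i) (y i)) \<le> L2_set (\<lambda>i. norm (x i)) J * L2_set (\<lambda>i. norm (y i)) J"
proof -
  interpret hilbert_space smul ip by fact
  have "norm (\<Sum>i\<in>J. ip (x i) (y i)) \<le> (\<Sum>i\<in>J. \<bar>norm (x i)\<bar> * \<bar>norm (y i)\<bar>)"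
    by (rule sum_norm_le) (simp add: Cauchy_Schwarz)
  also have "\<dots> \<le> L2_set (\<lambda>i. norm (x i)) J * L2_set (\<lambda>i. norm (y i)) J"
    by (rule L2_set_mult_ineq)
  finally show ?thesis .
qed

lemma g_frame_bounds_L2_set_le:
  assumes "g_frame_bounds I \<Lambda> A B" and "finite J" and "J \<subseteq> I"
  shows "L2_set (\<lambda>i. norm (\<Lambda> i f)) J \<le> sqrt B * norm f"
proof -
  have "(\<Sum>i\<in>J. (norm (\<Lambda> i f))\<^sup>2) \<le> (\<Sum>\<^sub>\<infinity>i\<in>I. (norm (\<Lambda> i f))\<^sup>2)"
    using assms by (intro finite_sum_le_infsum) (auto simp: g_frame_bounds_def)
  also have "\<dots> \<le> B * (norm f)\<^sup>2" using assms(1) by (simp add: g_frame_bounds_def)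
  finally have "L2_set (\<lambda>i. norm (\<Lambda> i f)) J \<le> sqrt (B * (norm f)\<^sup>2)"
    unfolding L2_set_def by (rule real_sqrt_le_mono)
  then show ?thesis by (simp add: real_sqrt_mult)
qed

text \<open>Duality: synthesis is adjoint to analysis, so it inherits the bound
  \<open>sqrt B\<close>. Pairing \<open>?u\<close> with itself and moving the adjoints across leaves
  the analysis sequence of \<open>?u\<close>.\<close>

lemma g_frame_synthesis_le:
  assumes "hilbert_space smulH ipH" and "hilbert_space smulK ipK"
    and "\<And>i. i \<in> J \<Longrightarrow> bounded_operator_into smulH smulK (V i) (\<Lambda> i)"
    and "g_frame_bounds I \<Lambda> A B" and "finite J" and "J \<subseteq> I"
  shows "norm (\<Sum>i\<in>J. hilbert_adjoint ipH ipK (\<Lambda> i) (g i)) \<le> sqrt B * L2_set (\<lambda>i. norm (g i)) J"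
    (is "norm ?u \<le> _")
proof -
  interpret H: hilbert_space smulH ipH by fact
  have "(norm ?u)\<^sup>2 = norm (\<Sum>i\<in>J. ipH ?u (hilbert_adjoint ipH ipK (\<Lambda> i) (g i)))"
    by (simp only: H.norm_ip_self H.ip_sum_right[symmetric])
  also have "\<dots> = norm (\<Sum>i\<in>J. ipK (\<Lambda> i ?u) (g i))"
    by (intro arg_cong[of _ _ norm] sum.cong refl hilbert_adjoint[OF assms(1-3), symmetric])
  also have "\<dots> \<le> L2_set (\<lambda>i. norm (\<Lambda> i ?u)) J * L2_set (\<lambda>i. norm (g i)) J"
    by (rule norm_sum_ip_le[OF assms(2)])
  also have "\<dots> \<le> (sqrt B * norm ?u) * L2_set (\<lambda>i. norm (g i)) J"
    by (intro mult_right_mono g_frame_bounds_L2_set_le[OF assms(4-6)]) simp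
  finally have "norm ?u * norm ?u \<le> norm ?u * (sqrt B * L2_set (\<lambda>i. norm (g i)) J)"
    by (simp add: power2_eq_square ac_simps)
  \<comment> \<open>Cancelling \<open>norm ?u\<close> requires it to be nonzero; when it vanishes,
    this nonnegativity is the claim.\<close>
  moreover have "0 \<le> sqrt B * L2_set (\<lambda>i. norm (g i)) J"
    using assms(4) by (simp add: g_frame_bounds_def less_imp_le)
  ultimately show ?thesis
    by (cases "norm ?u = 0") (auto dest: mult_left_le_imp_le)
qed

text \<open>Testing the bound on the difference of the synthesis operators at
  \<open>g i = \<Lambda> i f - \<Gamma> i f\<close> bounds the difference of the analysis operators.\<close>
lemma L2_set_diff_le:
  assumes "hilbert_space smulH ipH" and "hilbert_space smulK ipK"
    and \<Lambda>: "\<And>i. i \<in> J \<Longrightarrow> bounded_operator_into smulH smulK (V i) (\<Lambda> i)"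
    and \<Gamma>: "\<And>i. i \<in> J \<Longrightarrow> bounded_operator_into smulH smulK (V i) (\<Gamma> i)"
    and bound: "norm (\<Sum>i\<in>J. hilbert_adjoint ipH ipK (\<Lambda> i) (\<Lambda> i f - \<Gamma> i f)
          - hilbert_adjoint ipH ipK (\<Gamma> i) (\<Lambda> i f - \<Gamma> i f))
        \<le> c * L2_set (\<lambda>i. norm (\<Lambda> i f - \<Gamma> i f)) J" (is "norm ?w \<le> c * ?L")
    and "0 \<le> c"
  shows "L2_set (\<lambda>i. norm (\<Lambda> i f - \<Gamma> i f)) J \<le> c * norm f"
proof -
  interpret H: hilbert_space smulH ipH by fact
  interpret K: hilbert_space smulK ipK by fact
  \<comment> \<open>Moving both adjoints across turns the pairing with \<open>f\<close> into a sum
    of squared norms, which is what the choice of test vectors is for.\<close>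
  have "ipH f ?w = (\<Sum>i\<in>J. ipK (\<Lambda> i f - \<Gamma> i f) (\<Lambda> i f - \<Gamma> i f))"
    unfolding H.ip_sum_right H.ip_diff_right K.ip_diff_left
    by (intro sum.cong refl arg_cong2[of _ _ _ _ "(-)"]
        hilbert_adjoint[OF assms(1-3), symmetric] hilbert_adjoint[OF assms(1,2,4), symmetric])
  also have "\<dots> = of_real (?L\<^sup>2)"
    by (simp add: K.ip_self L2_set_def sum_nonneg)
  finally have "?L\<^sup>2 = norm (ipH f ?w)" by (simp del: of_real_power)
  also have "\<dots> \<le> norm f * norm ?w" by (rule H.Cauchy_Schwarz)
  also have "\<dots> \<le> norm f * (c * ?L)" by (intro mult_left_mono bound) simp
  finally have "?L * ?L \<le> ?L * (c * norm f)" by (simp add: power2_eq_square ac_simps)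
  moreover have "0 \<le> ?L" "0 \<le> c * norm f" using \<open>0 \<le> c\<close> by simp_all
  ultimately show ?thesis
    by (cases "?L = 0") (auto dest: mult_left_le_imp_le)
qed

section \<open>Sums along a finite partition, and perturbation on one part\<close>

lemma has_sum_finite_UN_disjoint:
  fixes f :: "'a \<Rightarrow> 'b::topological_comm_monoid_add"
  assumes "finite F" and "disjoint_family_on S F"
    and "\<And>j. j \<in> F \<Longrightarrow> (f has_sum s j) (S j)"
  shows "(f has_sum (\<Sum>j\<in>F. s j)) (\<Union>j\<in>F. S j)"
  using assms
proof (induction F rule: finite_induct)
  case (insert k F)
  then have "S k \<inter> (\<Union>j\<in>F. S j) = {}"
    by (auto simp: disjoint_family_on_def)
  moreover have "(f has_sum (\<Sum>j\<in>F. s j)) (\<Union>j\<in>F. S j)"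
    using insert by (auto intro!: insert.IH simp: disjoint_family_on_def)
  ultimately show ?case
    using insert by (auto intro!: has_sum_Un_disjoint)
qed simp

text \<open>Tagging each index \<open>i\<close> with its \<open>j\<close> makes the slices disjoint.
  This is the shape of the index set of a weaving.\<close>

lemma has_sum_finite_Sigma_swap:
  fixes a :: "'i \<Rightarrow> 'j \<Rightarrow> 'b::topological_comm_monoid_add"
  assumes "finite F" and "\<And>j. j \<in> F \<Longrightarrow> ((\<lambda>i. a i j) has_sum s j) (S j)"
  shows "((\<lambda>(i, j). a i j) has_sum (\<Sum>j\<in>F. s j)) {(i, j). j \<in> F \<and> i \<in> S j}"
proof -
  have "((\<lambda>(i, j). a i j) has_sum (\<Sum>j\<in>F. s j)) (\<Union>j\<in>F. (\<lambda>i. (i, j)) ` S j)"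
  proof (rule has_sum_finite_UN_disjoint[OF assms(1)])
    show "disjoint_family_on (\<lambda>j. (\<lambda>i. (i, j)) ` S j) F"
      by (auto simp: disjoint_family_on_def)
    show "((\<lambda>(i, j). a i j) has_sum s j) ((\<lambda>i. (i, j)) ` S j)" if "j \<in> F" for j
      using assms(2)[OF that] by (simp add: has_sum_reindex inj_on_def o_def)
  qed
  also have "(\<Union>j\<in>F. (\<lambda>i. (i, j)) ` S j) = {(i, j). j \<in> F \<and> i \<in> S j}" by auto
  finally show ?thesis .
qed

lemma g_frame_bounds_infsum_le:
  assumes "g_frame_bounds I \<Lambda> A B" and "S \<subseteq> I"
  shows "(\<Sum>\<^sub>\<infinity>i\<in>S. (norm (\<Lambda> i f))\<^sup>2) \<le> B * (norm f)\<^sup>2"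
proof -
  have sm: "(\<lambda>i. (norm (\<Lambda> i f))\<^sup>2) summable_on I"
    using assms(1) by (simp add: g_frame_bounds_def)
  then have "(\<Sum>\<^sub>\<infinity>i\<in>S. (norm (\<Lambda> i f))\<^sup>2) \<le> (\<Sum>\<^sub>\<infinity>i\<in>I. (norm (\<Lambda> i f))\<^sup>2)"
    using assms(2) by (intro infsum_mono2 summable_on_subset_banach[OF sm]) auto
  also have "\<dots> \<le> B * (norm f)\<^sup>2" using assms(1) by (simp add: g_frame_bounds_def)
  finally show ?thesis .
qed

text \<open>With \<open>a\<close>, \<open>b\<close> the l2 norms of the analysis sequences over a finite set, the estimate is
  \<open>a\<^sup>2 - b\<^sup>2 = (a - b) (a + b) \<le> c \<parallel>f\<parallel> (\<surd>B + \<surd>B') \<parallel>f\<parallel>\<close>.\<close>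
lemma g_frame_infsum_perturbation:
  assumes \<Lambda>: "g_frame_bounds I \<Lambda> A B" and \<Gamma>: "g_frame_bounds I \<Gamma> A' B'" and "S \<subseteq> I"
    and "0 \<le> c"
    and diff: "\<And>J. finite J \<Longrightarrow> J \<subseteq> S \<Longrightarrow> L2_set (\<lambda>i. norm (\<Lambda> i f - \<Gamma> i f)) J \<le> c * norm f"
  shows "(\<Sum>\<^sub>\<infinity>i\<in>S. (norm (\<Lambda> i f))\<^sup>2)
    \<le> (\<Sum>\<^sub>\<infinity>i\<in>S. (norm (\<Gamma> i f))\<^sup>2) + c * (sqrt B + sqrt B') * (norm f)\<^sup>2"
\<comment> \<open>The difference estimate concerns finite sets, so the infinite sum is bounded
  through its finite partial sums.\<close>
proof (rule infsum_le_finite_sums)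
  show "(\<lambda>i. (norm (\<Lambda> i f))\<^sup>2) summable_on S"
    using \<Lambda> \<open>S \<subseteq> I\<close> summable_on_subset_banach unfolding g_frame_bounds_def by blast
next
  fix J assume J: "finite J" "J \<subseteq> S"
  define a where "a = L2_set (\<lambda>i. norm (\<Lambda> i f)) J"
  define b where "b = L2_set (\<lambda>i. norm (\<Gamma> i f)) J"
  have "J \<subseteq> I" using J \<open>S \<subseteq> I\<close> by blast
  have "a \<le> L2_set (\<lambda>i. norm (\<Lambda> i f - \<Gamma> i f) + norm (\<Gamma> i f)) J"
    unfolding a_def
  proof (rule L2_set_mono)
    show "norm (\<Lambda> i f) \<le> norm (\<Lambda> i f - \<Gamma> i f) + norm (\<Gamma> i f)" for i
      using norm_triangle_ineq[of "\<Lambda> i f - \<Gamma> i f" "\<Gamma> i f"] by simp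
  qed simp
  also have "\<dots> \<le> L2_set (\<lambda>i. norm (\<Lambda> i f - \<Gamma> i f)) J + b"
    unfolding b_def by (rule L2_set_triangle_ineq)
  also have "\<dots> \<le> c * norm f + b" using diff[OF J] by simp
  finally have ab: "a - b \<le> c * norm f" by simp
  have "a + b \<le> (sqrt B + sqrt B') * norm f"
    using g_frame_bounds_L2_set_le[OF \<Lambda> J(1) \<open>J \<subseteq> I\<close>, of f]
      g_frame_bounds_L2_set_le[OF \<Gamma> J(1) \<open>J \<subseteq> I\<close>, of f]
    by (simp add: a_def b_def distrib_right)
  \<comment> \<open>Here \<open>a - b\<close> may be negative; monotonicity of the product rests on
    \<open>a + b\<close> and \<open>c * norm f\<close> being nonnegative.\<close>
  then have "(a - b) * (a + b) \<le> c * norm f * ((sqrt B + sqrt B') * norm f)"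
    using \<open>0 \<le> c\<close> ab by (intro mult_mono) (auto simp: a_def b_def)
  then have "a\<^sup>2 - b\<^sup>2 \<le> c * (sqrt B + sqrt B') * (norm f)\<^sup>2"
    by (simp add: power2_eq_square algebra_simps)
  moreover have "a\<^sup>2 = (\<Sum>i\<in>J. (norm (\<Lambda> i f))\<^sup>2)" "b\<^sup>2 = (\<Sum>i\<in>J. (norm (\<Gamma> i f))\<^sup>2)"
    by (simp_all add: a_def b_def L2_set_def sum_nonneg)
  moreover have "(\<Sum>i\<in>J. (norm (\<Gamma> i f))\<^sup>2) \<le> (\<Sum>\<^sub>\<infinity>i\<in>S. (norm (\<Gamma> i f))\<^sup>2)"
  proof (rule finite_sum_le_infsum)
    show "(\<lambda>i. (norm (\<Gamma> i f))\<^sup>2) summable_on S"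
      using \<Gamma> \<open>S \<subseteq> I\<close> summable_on_subset_banach unfolding g_frame_bounds_def by blast
  qed (use J in auto)
  ultimately show "(\<Sum>i\<in>J. (norm (\<Lambda> i f))\<^sup>2)
      \<le> (\<Sum>\<^sub>\<infinity>i\<in>S. (norm (\<Gamma> i f))\<^sup>2) + c * (sqrt B + sqrt B') * (norm f)\<^sup>2"
    by linarith
qed

section \<open>Weaving along an arbitrary partition\<close>

theorem theorem5p1:
  fixes smulH :: "'k::rc_field \<Rightarrow> 'h::banach \<Rightarrow> 'h" and ipH :: "'h \<Rightarrow> 'h \<Rightarrow> 'k"
    and smulK :: "'k \<Rightarrow> 'b::banach \<Rightarrow> 'b" and ipK :: "'b \<Rightarrow> 'b \<Rightarrow> 'k"
    and I :: "nat set" and m n :: nat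
    and V :: "nat \<Rightarrow> 'b set"
    and \<Lambda> :: "nat \<Rightarrow> nat \<Rightarrow> 'h \<Rightarrow> 'b"
    and A\<^sub>0 :: real and A B lam \<eta> \<mu> :: "nat \<Rightarrow> real"
  assumes "hilbert_space smulH ipH" and "hilbert_space smulK ipK"
    and "\<And>i. i \<in> I \<Longrightarrow> closed_subspace smulK (V i)"
    and "\<And>i j. i \<in> I \<Longrightarrow> j \<in> {1..m} \<Longrightarrow> bounded_operator_into smulH smulK (V i) (\<Lambda> i j)"
    and "\<And>j. j \<in> {1..m} \<Longrightarrow> g_frame_bounds I (\<lambda>i. \<Lambda> i j) (A j) (B j)"
    and "\<And>j. j \<in> {1..m} \<Longrightarrow> lam j \<ge> 0 \<and> \<eta> j \<ge> 0 \<and> \<mu> j \<ge> 0"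
    and "n \<in> {1..m}"
    and "A\<^sub>0 = A n - (\<Sum>j\<in>{1..m} - {n}.
           (lam j + \<eta> j * sqrt (B n) + \<mu> j * sqrt (B j)) * (sqrt (B n) + sqrt (B j)))"
    and "A\<^sub>0 > 0"
    and "\<And>J g j. finite J \<Longrightarrow> J \<subseteq> I \<Longrightarrow> (\<And>i. i \<in> J \<Longrightarrow> g i \<in> V i) \<Longrightarrow> j \<in> {1..m} - {n} \<Longrightarrow>
           norm (\<Sum>i\<in>J. hilbert_adjoint ipH ipK (\<Lambda> i n) (g i) - hilbert_adjoint ipH ipK (\<Lambda> i j) (g i))
             \<le> \<eta> j * norm (\<Sum>i\<in>J. hilbert_adjoint ipH ipK (\<Lambda> i n) (g i))
               + \<mu> j * norm (\<Sum>i\<in>J. hilbert_adjoint ipH ipK (\<Lambda> i j) (g i))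
               + lam j * sqrt (\<Sum>i\<in>J. (norm (g i))\<^sup>2)"
  shows "(\<forall>\<sigma>. is_partition I m \<sigma> \<longrightarrow>
             weaving_g_frame_bounds m \<sigma> \<Lambda> A\<^sub>0 (\<Sum>j\<in>{1..m}. B j))
         \<and> woven I m \<Lambda>"
proof -
  interpret K: hilbert_space smulK ipK by fact
  \<comment> \<open>\<open>c j\<close> will bound the \<open>n\<close>-th minus the
    \<open>j\<close>-th analysis operator, and \<open>d j\<close> the resulting loss on part
    \<open>j\<close>; thus \<open>A\<^sub>0\<close> is \<open>A n\<close> minus the sum of the
    \<open>d j\<close>.\<close>
  define c where "c j = lam j + \<eta> j * sqrt (B n) + \<mu> j * sqrt (B j)" for j
  define d where "d j = c j * (sqrt (B n) + sqrt (B j))" for j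
  note frame = assms(5)
  have nonneg: "0 \<le> lam j" "0 \<le> \<eta> j" "0 \<le> \<mu> j" "0 < B j" if "j \<in> {1..m}" for j
    using assms(6)[OF that] frame[OF that] by (auto simp: g_frame_bounds_def)
  have c: "0 \<le> c j" if "j \<in> {1..m}" for j
    using nonneg[OF that] nonneg[OF assms(7)] by (simp add: c_def)
  have diff: "L2_set (\<lambda>i. norm (\<Lambda> i n f - \<Lambda> i j f)) J \<le> c j * norm f"
    if J: "finite J" "J \<subseteq> I" and j: "j \<in> {1..m} - {n}" for J j f
  proof (rule L2_set_diff_le[OF assms(1,2)])
    define g where "g i = \<Lambda> i n f - \<Lambda> i j f" for i
    have j': "j \<in> {1..m}" using j by simp
    show op: "bounded_operator_into smulH smulK (V i) (\<Lambda> i n)"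
      "bounded_operator_into smulH smulK (V i) (\<Lambda> i j)" if "i \<in> J" for i
      using that J j assms(4,7) by auto
    \<comment> \<open>The perturbation hypothesis admits only test vectors from the subspaces
      \<open>V i\<close>.\<close>
    have V: "g i \<in> V i" if "i \<in> J" for i
    proof -
      have "K.subspace (V i)"
        using assms(3) that J by (auto simp: closed_subspace_def)
      then show ?thesis
        using op[OF that] unfolding g_def
        by (intro K.subspace_diff) (auto simp: bounded_operator_into_def)
    qed
    let ?G = "L2_set (\<lambda>i. norm (g i)) J"
    have "norm (\<Sum>i\<in>J. hilbert_adjoint ipH ipK (\<Lambda> i n) (g i) - hilbert_adjoint ipH ipK (\<Lambda> i j) (g i))
        \<le> \<eta> j * norm (\<Sum>i\<in>J. hilbert_adjoint ipH ipK (\<Lambda> i n) (g i))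
          + \<mu> j * norm (\<Sum>i\<in>J. hilbert_adjoint ipH ipK (\<Lambda> i j) (g i)) + lam j * ?G"
      unfolding L2_set_def by (rule assms(10)[OF J V j])
    \<comment> \<open>The synthesis bounds convert the \<open>\<eta>\<close> and
      \<open>\<mu>\<close> terms into multiples of \<open>?G\<close>, so that a single constant
      remains.\<close>
    also have "\<dots> \<le> \<eta> j * (sqrt (B n) * ?G) + \<mu> j * (sqrt (B j) * ?G) + lam j * ?G"
      by (intro add_mono mult_left_mono order_refl nonneg j'
          g_frame_synthesis_le[OF assms(1,2) op(1) frame[OF assms(7)] J]
          g_frame_synthesis_le[OF assms(1,2) op(2) frame[OF j'] J])
    also have "\<dots> = c j * ?G" by (simp add: c_def algebra_simps)
    finally show "norm (\<Sum>i\<in>J. hilbert_adjoint ipH ipK (\<Lambda> i n) (\<Lambda> i n f - \<Lambda> i j f)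
          - hilbert_adjoint ipH ipK (\<Lambda> i j) (\<Lambda> i n f - \<Lambda> i j f))
        \<le> c j * L2_set (\<lambda>i. norm (\<Lambda> i n f - \<Lambda> i j f)) J"
      by (simp only: g_def)
    show "0 \<le> c j" by (rule c[OF j'])
  qed
  \<comment> \<open>Strict positivity needs a nonempty index range; \<open>n\<close> provides an
    element.\<close>
  have B: "0 < (\<Sum>j\<in>{1..m}. B j)"
    using assms(7) nonneg(4) by (intro sum_pos) auto
  have weaving: "weaving_g_frame_bounds m \<sigma> \<Lambda> A\<^sub>0 (\<Sum>j\<in>{1..m}. B j)" if \<sigma>: "is_partition I m \<sigma>" for \<sigma>
    unfolding weaving_g_frame_bounds_def g_frame_bounds_def
  proof (intro conjI allI)
    fix f
    let ?S = "{(i, j). j \<in> {1..m} \<and> i \<in> \<sigma> j}"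
    let ?s = "\<lambda>j. \<Sum>\<^sub>\<infinity>i\<in>\<sigma> j. (norm (\<Lambda> i j f))\<^sup>2"
    let ?t = "\<lambda>j. \<Sum>\<^sub>\<infinity>i\<in>\<sigma> j. (norm (\<Lambda> i n f))\<^sup>2"
    have sub: "\<sigma> j \<subseteq> I" if "j \<in> {1..m}" for j
      using \<sigma> that by (auto simp: is_partition_def)
    have summable: "(\<lambda>i. (norm (\<Lambda> i k f))\<^sup>2) summable_on \<sigma> j"
      if "j \<in> {1..m}" "k \<in> {1..m}" for j k
      using frame[OF that(2)] sub[OF that(1)] summable_on_subset_banach
      unfolding g_frame_bounds_def by blast
    have "((\<lambda>(i, j). (norm (\<Lambda> i j f))\<^sup>2) has_sum (\<Sum>j\<in>{1..m}. ?s j)) ?S"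
      by (intro has_sum_finite_Sigma_swap has_sum_infsum summable) auto
    then have sum: "((\<lambda>x. (norm ((case x of (i, j) \<Rightarrow> \<Lambda> i j) f))\<^sup>2) has_sum (\<Sum>j\<in>{1..m}. ?s j)) ?S"
      by (simp add: case_prod_unfold)
    then show "(\<lambda>x. (norm ((case x of (i, j) \<Rightarrow> \<Lambda> i j) f))\<^sup>2) summable_on ?S"
      by (rule has_sum_imp_summable)
    \<comment> \<open>For the single frame with index \<open>n\<close>, the parts reassemble to the
      full sum over \<open>I\<close>, to which its lower bound \<open>A n\<close> applies.\<close>
    have "((\<lambda>i. (norm (\<Lambda> i n f))\<^sup>2) has_sum (\<Sum>j\<in>{1..m}. ?t j)) (\<Union>j\<in>{1..m}. \<sigma> j)"
      using \<sigma> assms(7)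
      by (intro has_sum_finite_UN_disjoint has_sum_infsum summable) (auto simp: is_partition_def)
    then have "(\<Sum>j\<in>{1..m}. ?t j) = (\<Sum>\<^sub>\<infinity>i\<in>I. (norm (\<Lambda> i n f))\<^sup>2)"
      using \<sigma> by (simp add: is_partition_def infsumI)
    then have "A n * (norm f)\<^sup>2 \<le> (\<Sum>j\<in>{1..m}. ?t j)"
      using frame[OF assms(7)] by (simp add: g_frame_bounds_def)
    \<comment> \<open>Part \<open>n\<close> is split off because \<open>?t n\<close> and
      \<open>?s n\<close> coincide: no operator is replaced there, so nothing is lost.\<close>
    also have "\<dots> = ?t n + (\<Sum>j\<in>{1..m} - {n}. ?t j)"
      using assms(7) by (simp add: sum.remove)
    also have "\<dots> \<le> ?s n + (\<Sum>j\<in>{1..m} - {n}. ?s j + d j * (norm f)\<^sup>2)"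
    proof (intro add_left_mono sum_mono)
      fix j assume j: "j \<in> {1..m} - {n}"
      then have j': "j \<in> {1..m}" by simp
      show "?t j \<le> ?s j + d j * (norm f)\<^sup>2"
        unfolding d_def
        by (rule g_frame_infsum_perturbation[OF frame[OF assms(7)] frame[OF j'] sub[OF j'] c[OF j']])
          (use sub[OF j'] j in \<open>blast intro: diff\<close>)
    qed
    also have "\<dots> = (\<Sum>j\<in>{1..m}. ?s j) + (\<Sum>j\<in>{1..m} - {n}. d j) * (norm f)\<^sup>2"
      using assms(7) by (simp add: sum.remove sum.distrib sum_distrib_right)
    finally have "A\<^sub>0 * (norm f)\<^sup>2 \<le> (\<Sum>j\<in>{1..m}. ?s j)"
      by (simp add: assms(8) c_def d_def left_diff_distrib)
    then show "A\<^sub>0 * (norm f)\<^sup>2 \<le> (\<Sum>\<^sub>\<infinity>x\<in>?S. (norm ((case x of (i, j) \<Rightarrow> \<Lambda> i j) f))\<^sup>2)"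
      by (simp only: infsumI[OF sum])
    \<comment> \<open>For the upper bound, each part is estimated by the whole frame it is taken
      from.\<close>
    have "(\<Sum>j\<in>{1..m}. ?s j) \<le> (\<Sum>j\<in>{1..m}. B j * (norm f)\<^sup>2)"
      by (intro sum_mono g_frame_bounds_infsum_le[OF frame sub])
    then show "(\<Sum>\<^sub>\<infinity>x\<in>?S. (norm ((case x of (i, j) \<Rightarrow> \<Lambda> i j) f))\<^sup>2) \<le> (\<Sum>j\<in>{1..m}. B j) * (norm f)\<^sup>2"
      by (simp only: infsumI[OF sum] sum_distrib_right)
  qed (use assms(9) B in auto)
  moreover have "woven I m \<Lambda>"
    unfolding woven_def using frame weaving assms(9) B by blast
  ultimately show ?thesis by blast
qed

end
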